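(* Let $q=2$, $n\ge5$ odd, $m=\frac{2^n+1}{3}$, $g=(q-1)(q^{n+1}+q^n-q^2)/2$ and $N=q^{2n+2}-q^{n+3}+q^{n+2}$. Let $\ell\in[g,3g-1]$ be an integer such that $\rho_{\ell+1}\in H(P_\infty)$ is of type $(0,1,k)$, i.e. $\rho_{\ell+1}=2m+8k$, for some integer $k\in[m,2m)$. Let $s\in[1,N-2\ell-5]$ be an integer. Then there exists a quantum code with parameters $[[N,s,D]]_{q^{2n}}$ where $$D\ge\ell+1-g+\begin{cases}5, & \text{if } k<m \text{ or } m\le k<\frac{9m-11}{8},\\ 3, & \text{if } \frac{9m-11}{8}\le k<\frac{11m-9}{8},\\ 1, & \text{if } \frac{11m-9}{8}\le k.\end{cases}$$
   Context: Let $GGS(2,n)$ be (the nonsingular model of) the curve $X^2+X=Y^{3}$, $Y^{4}-Y=Z^m$, $m=(2^n+1)/3$; it is $\mathbb F_{2^{2n}}$-maximal of genus $g=\frac{9m-7}{2}$ and has a unique point at infinity $P_\infty$. The Weierstrass semigroup at $P_\infty$ is known to be $H(P_\infty)=\{3im+2jm+8k\mid i\in\{0,1\},\ j\in\{0,1,2,3\},\ k\ge0\}=\{\rho_1=0<\rho_2<\cdots\}$, where each element has a unique such representation and $(i,j,k)$ denotes $3im+2jm+8k$. For a prime power $Q$, a $Q$-ary quantum code of length $N$ and dimension $k'$ is a $Q^{k'}$-dimensional Hilbert subspace of $(\mathbb C^Q)^{\otimes N}$; $[[N,k',D]]_Q$ denotes such a code with minimum distance $D$ (a code of minimum distance $D$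 can correct up to $\lfloor (D-1)/2\rfloor$ quantum errors). The standard CSS construction says: if $C_1\subset C_2$ are linear codes over $\mathbb F_Q$ of length $N$ and dimensions $k_1,k_2$, then there exists an $[[N,k_2-k_1,D]]_Q$ code with $D=\min\{wt(c)\mid c\in(C_2\setminus C_1)\cup(C_1^\perp\setminus C_2^\perp)\}$, where $wt$ is the Hamming weight. *)

theory Defs
  imports Complex_Main "HOL-Library.FuncSet" "HOL-Library.Function_Algebras"
    "HOL-Library.Infinite_Set"
begin

section \<open>The Weierstrass semigroup at infinity of the curve GGS(2,n)\<close>

definition GGS_elt :: "nat \<Rightarrow> nat \<Rightarrow> nat \<Rightarrow> nat \<Rightarrow> nat" where
  "GGS_elt m i j k = 3 * i * m + 2 * j * m + 8 * k"

text \<open>With \<open>m = (2 ^ n + 1) / 3\<close>, the summands \<open>3m\<close>, \<open>2m\<close>, \<open>8\<close> are the pole orders at the point at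
  infinity of the coordinate functions of the curve
  \<open>X\<^sup>2 + X = Y ^ 3\<close>, \<open>Y ^ 4 - Y = Z ^ m\<close>.  The semigroup is given by its known
  explicit description in terms of these.\<close>

definition GGS_semigroup :: "nat \<Rightarrow> nat set" where
  "GGS_semigroup m = {GGS_elt m i j k | i j k. i \<in> {0, 1} \<and> j \<in> {0, 1, 2, 3}}"

text \<open>The elements in increasing order, numbered from 1: \<open>GGS_rho m 1 = 0\<close>.  Only arguments
  \<open>l \<ge> 1\<close> are meaningful.\<close>

definition GGS_rho :: "nat \<Rightarrow> nat \<Rightarrow> nat" where
  "GGS_rho m l = enumerate (GGS_semigroup m) (l - 1)"


section \<open>Quantum codes\<close>

text \<open>The space \<open>(\<complex> ^ Q) ^ \<otimes>N\<close> is modelled by its coordinates in the standard product basis,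
  which is indexed by the words of length \<open>N\<close> over \<open>{0, \<dots>, Q - 1}\<close>.\<close>

definition words :: "nat \<Rightarrow> nat \<Rightarrow> (nat \<Rightarrow> nat) set" where
  "words Q N = ({..<N} \<rightarrow>\<^sub>E {..<Q})"

type_synonym qvec = "(nat \<Rightarrow> nat) \<Rightarrow> complex"

definition qspace :: "nat \<Rightarrow> nat \<Rightarrow> qvec set" where
  "qspace Q N = {u. \<forall>x. x \<notin> words Q N \<longrightarrow> u x = 0}"

definition qscale :: "complex \<Rightarrow> qvec \<Rightarrow> qvec" where
  "qscale c u = (\<lambda>x. c * u x)"

interpretation qvec: vector_space qscale
  by unfold_locales (auto simp: qscale_def fun_eq_iff algebra_simps)

definition qinner :: "nat \<Rightarrow> nat \<Rightarrow> qvec \<Rightarrow> qvec \<Rightarrow> complex" where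
  "qinner Q N u v = (\<Sum>x\<in>words Q N. cnj (u x) * v x)"

text \<open>An error is a tensor product of \<open>N\<close> linear operators on \<open>\<complex> ^ Q\<close>; \<open>E i a b\<close> is the \<open>(a, b)\<close>
  matrix entry of the operator on the \<open>i\<close>-th tensor factor (\<open>i < N\<close> and \<open>a, b < Q\<close>; other values
  are irrelevant).  Its weight is the number of factors different from the identity.\<close>

type_synonym qerror = "nat \<Rightarrow> nat \<Rightarrow> nat \<Rightarrow> complex"

definition apply_error :: "nat \<Rightarrow> nat \<Rightarrow> qerror \<Rightarrow> qvec \<Rightarrow> qvec" where
  "apply_error Q N E u =
     (\<lambda>x. if x \<in> words Q N then \<Sum>y\<in>words Q N. (\<Prod>i<N. E i (x i) (y i)) * u y else 0)"

definition error_weight :: "nat \<Rightarrow> nat \<Rightarrow> qerror \<Rightarrow> nat" where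
  "error_weight Q N E =
     card {i \<in> {..<N}. \<exists>a<Q. \<exists>b<Q. E i a b \<noteq> (if a = b then 1 else 0)}"

text \<open>The Knill--Laflamme condition \<open>P E P = c P\<close>, where \<open>P\<close> is the orthogonal projection onto
  \<open>C\<close>.\<close>

definition detectable :: "nat \<Rightarrow> nat \<Rightarrow> qvec set \<Rightarrow> qerror \<Rightarrow> bool" where
  "detectable Q N C E \<longleftrightarrow>
     (\<exists>c. \<forall>u\<in>C. \<forall>v\<in>C. qinner Q N u (apply_error Q N E v) = c * qinner Q N u v)"

text \<open>\<open>C\<close> is an \<open>[[N, k, D]]\<close> code over the alphabet size \<open>Q\<close>: a subspace of dimension \<open>Q ^ k\<close>
  that detects all errors of weight less than \<open>D\<close>, but not all errors of weight \<open>D\<close>.  The operators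
  supported on a fixed set of tensor factors are spanned both by the tensor products of arbitrary
  operators on these factors and by those of generalized Pauli operators, and detectable operators
  form a linear space; so \<open>D\<close> is the same for either class of errors.  One-dimensional codes detect
  every error, so the definition is meaningful for \<open>k \<ge> 1\<close> only.\<close>

definition quantum_code :: "nat \<Rightarrow> nat \<Rightarrow> nat \<Rightarrow> nat \<Rightarrow> qvec set \<Rightarrow> bool" where
  "quantum_code Q N k D C \<longleftrightarrow>
     C \<subseteq> qspace Q N \<and> qvec.subspace C \<and> qvec.dim C = Q ^ k \<and>
     (\<forall>E. error_weight Q N E < D \<longrightarrow> detectable Q N C E) \<and>
     (\<exists>E. error_weight Q N E = D \<and> \<not> detectable Q N C E)"

end

theory Submission
  imports Defs
begin

text \<open>The parameters already follow from the quantum Gilbert--Varshamov bound.  Put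
  \<open>w = 2 ^ n\<close>, \<open>Q = w\<^sup>2\<close> and \<open>t = l + 5 - g\<close>.  At most \<open>(N choose t) * Q ^ (2 * t)\<close> Pauli operators have
  weight at most \<open>t\<close>.  One builds an isotropic group of Pauli operators by
  adjoining one element at a time, choosing it such that the number of low-weight operators which
  commute with the group without belonging to it is at least halved.  After enough steps none is left,
  and the joint eigenspace of the group is a stabilizer code of distance greater than \<open>t\<close>.  This
  works as soon as \<open>(N choose t) * Q ^ (2 * t) < Q ^ (N - s)\<close>.  Since \<open>N - s \<ge> 2 * l + 5\<close> and
  \<open>2 * g = 3 * w - 4\<close>, this reduces to \<open>N choose t < w ^ (2 * (3 * w - 9))\<close>, where \<open>t \<le> 3 * w\<close> and
  \<open>N = 4 * w\<^sup>2 - 4 * w\<close>.\<close>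

text \<open>Reindexing by the involution \<open>h\<close> turns the sum into its own negative. Both
  character sums and Pauli coefficients will be shown to vanish this way.\<close>

lemma sum_sign_reversing_involution:
  fixes f :: "'a \<Rightarrow> 'b::{ab_group_add, semiring_1_no_zero_divisors, semiring_char_0}"
  assumes "\<And>x. x \<in> A \<Longrightarrow> h x \<in> A" "\<And>x. x \<in> A \<Longrightarrow> h (h x) = x"
    and "\<And>x. x \<in> A \<Longrightarrow> f (h x) = - f x"
  shows "sum f A = 0"
proof -
  have "sum f A = sum (\<lambda>x. - f x) A"
    by (rule sum.reindex_bij_witness[of _ h h]) (use assms in auto)
  also have "\<dots> = - sum f A"
    by (simp add: sum_negf)
  finally have "2 * sum f A = 0"
    by (metis add.left_inverse mult_2)
  then show ?thesis
    by simp
qed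

section \<open>Isotropic subgroups of elementary abelian 2-groups\<close>

text \<open>In effect, a finite vector space over the field with two elements with a nondegenerate
  symmetric form, written multiplicatively with values \<open>1\<close> and \<open>- 1\<close>.
  There are two instances: words under \<open>wchar\<close> and Pauli labels under
  \<open>pform\<close>.\<close>

locale bicharacter_group =
  fixes G :: "'a set" and add :: "'a \<Rightarrow> 'a \<Rightarrow> 'a" (infixl "\<oplus>" 65) and zero :: 'a ("\<zero>")
    and \<omega> :: "'a \<Rightarrow> 'a \<Rightarrow> int"
  assumes finite_G [simp]: "finite G"
    and add_closed [simp]: "\<lbrakk>x \<in> G; y \<in> G\<rbrakk> \<Longrightarrow> x \<oplus> y \<in> G"
    and zero_closed [simp]: "\<zero> \<in> G"
    and add_assoc: "\<lbrakk>x \<in> G; y \<in> G; z \<in> G\<rbrakk> \<Longrightarrow> (x \<oplus> y) \<oplus> z = x \<oplus> (y \<oplus> z)"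
    and add_commute: "\<lbrakk>x \<in> G; y \<in> G\<rbrakk> \<Longrightarrow> x \<oplus> y = y \<oplus> x"
    and add_zero [simp]: "x \<in> G \<Longrightarrow> x \<oplus> \<zero> = x"
    and add_self [simp]: "x \<in> G \<Longrightarrow> x \<oplus> x = \<zero>"
    and omega_cases: "\<lbrakk>x \<in> G; y \<in> G\<rbrakk> \<Longrightarrow> \<omega> x y = 1 \<or> \<omega> x y = - 1"
    and omega_add: "\<lbrakk>x \<in> G; y \<in> G; z \<in> G\<rbrakk> \<Longrightarrow> \<omega> (x \<oplus> y) z = \<omega> x z * \<omega> y z"
    and omega_sym: "\<lbrakk>x \<in> G; y \<in> G\<rbrakk> \<Longrightarrow> \<omega> x y = \<omega> y x"
    and omega_nondegenerate: "\<lbrakk>x \<in> G; x \<noteq> \<zero>\<rbrakk> \<Longrightarrow> \<exists>y\<in>G. \<omega> x y = - 1"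
begin

lemma add_cancel [simp]: "\<lbrakk>x \<in> G; y \<in> G\<rbrakk> \<Longrightarrow> (x \<oplus> y) \<oplus> y = x"
  by (simp add: add_assoc)

lemma omega_add_right: "\<lbrakk>x \<in> G; y \<in> G; z \<in> G\<rbrakk> \<Longrightarrow> \<omega> x (y \<oplus> z) = \<omega> x y * \<omega> x z"
  by (metis add_closed omega_add omega_sym)

lemma omega_zero [simp]: "x \<in> G \<Longrightarrow> \<omega> x \<zero> = 1"
  using omega_add_right[of x "\<zero>" "\<zero>"] omega_cases[of x "\<zero>"] by auto

lemma omega_zero_left [simp]: "x \<in> G \<Longrightarrow> \<omega> \<zero> x = 1"
  using omega_sym[of "\<zero>" x] by simp

lemma omega_square [simp]: "\<lbrakk>x \<in> G; y \<in> G\<rbrakk> \<Longrightarrow> \<omega> x y * \<omega> x y = 1"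
  using omega_cases[of x y] by auto

section \<open>Subgroups and their orthogonal complements\<close>

definition subgrp :: "'a set \<Rightarrow> bool" where
  "subgrp S \<longleftrightarrow> S \<subseteq> G \<and> \<zero> \<in> S \<and> (\<forall>x\<in>S. \<forall>y\<in>S. x \<oplus> y \<in> S)"

definition perp :: "'a set \<Rightarrow> 'a set" where
  "perp S = {x \<in> G. \<forall>s\<in>S. \<omega> x s = 1}"

lemma subgrp_G: "subgrp G"
  by (auto simp: subgrp_def)

lemma subgrp_perp: "S \<subseteq> G \<Longrightarrow> subgrp (perp S)"
  by (auto simp: subgrp_def perp_def omega_add subset_iff)

text \<open>Character orthogonality: if \<open>x\<close> is not orthogonal to some
  \<open>t \<in> S\<close>, then translation by \<open>t\<close> reverses the sign of every
  term.\<close>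

lemma sum_omega_subgrp:
  assumes S: "subgrp S" and x: "x \<in> G"
  shows "(\<Sum>y\<in>S. \<omega> x y) = (if x \<in> perp S then int (card S) else 0)"
proof (cases "x \<in> perp S")
  case True
  then show ?thesis by (simp add: perp_def)
next
  case False
  then obtain t where t: "t \<in> S" "\<omega> x t = - 1"
    using x S omega_cases[of x] by (auto simp: perp_def subgrp_def subset_iff)
  have SG: "y \<in> G" if "y \<in> S" for y
    using S that by (auto simp: subgrp_def)
  have "(\<Sum>y\<in>S. \<omega> x y) = 0"
    by (rule sum_sign_reversing_involution[where h = "\<lambda>y. y \<oplus> t"])
      (use S t x SG in \<open>auto simp: subgrp_def omega_add_right\<close>)
  then show ?thesis using False by simp
qed

lemma perp_G: "perp G = {\<zero>}"
  using omega_nondegenerate by (fastforce simp: perp_def)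

lemma sum_omega: "x \<in> G \<Longrightarrow> (\<Sum>y\<in>G. \<omega> x y) = (if x = \<zero> then int (card G) else 0)"
  using sum_omega_subgrp[OF subgrp_G] by (simp add: perp_G)

text \<open>Double counting of \<open>\<Sum>x\<in>G. \<Sum>y\<in>S. \<omega> x y\<close>.\<close>

lemma card_perp:
  assumes S: "subgrp S"
  shows "card S * card (perp S) = card G"
proof -
  have SG: "S \<subseteq> G" "\<zero> \<in> S" using S by (auto simp: subgrp_def)
  have fin: "finite S" using SG finite_subset finite_G by blast
  have PG: "G \<inter> perp S = perp S" by (auto simp: perp_def)
  have "int (card S * card (perp S)) = (\<Sum>x\<in>G. if x \<in> perp S then int (card S) else 0)"
    by (simp add: sum.If_cases PG)
  also have "\<dots> = (\<Sum>x\<in>G. \<Sum>y\<in>S. \<omega> x y)"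
    using sum_omega_subgrp[OF S] by simp
  also have "\<dots> = (\<Sum>y\<in>S. \<Sum>x\<in>G. \<omega> x y)"
    by (rule sum.swap)
  also have "\<dots> = (\<Sum>y\<in>S. \<Sum>x\<in>G. \<omega> y x)"
    using SG by (intro sum.cong refl) (auto simp: omega_sym)
  also have "\<dots> = (\<Sum>y\<in>S. if y = \<zero> then int (card G) else 0)"
    using SG by (intro sum.cong refl sum_omega) auto
  also have "\<dots> = int (card G)"
    using SG fin by simp
  finally show ?thesis by (simp only: of_nat_eq_iff)
qed

text \<open>One inclusion follows from symmetry of \<open>\<omega>\<close>. Equality follows by
  counting, with \<open>card_perp\<close> applied to \<open>S\<close> and to
  \<open>perp S\<close>.\<close>

lemma perp_perp:
  assumes S: "subgrp S"
  shows "perp (perp S) = S"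
proof -
  have SG: "S \<subseteq> G" "\<zero> \<in> S" using S by (auto simp: subgrp_def)
  have "S \<subseteq> perp (perp S)"
    using SG by (auto simp: perp_def omega_sym subset_iff)
  moreover have "card S = card (perp (perp S))"
  proof -
    have "card (perp S) * card S = card (perp S) * card (perp (perp S))"
      using card_perp[OF S] card_perp[OF subgrp_perp[OF SG(1)]] by (simp add: mult.commute)
    moreover have "card (perp S) \<noteq> 0"
      using card_perp[OF S] zero_closed finite_G by (metis card_0_eq empty_iff mult_0_right)
    ultimately show ?thesis by simp
  qed
  moreover have "finite (perp (perp S))"
    by (auto simp: perp_def)
  ultimately show ?thesis
    by (metis card_subset_eq)
qed

text \<open>For a subgroup \<open>S\<close>, two cosets suffice to form the group generated by
  \<open>v\<close> and \<open>S\<close>, because \<open>v\<close> is its own inverse.\<close>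

definition adjoin :: "'a \<Rightarrow> 'a set \<Rightarrow> 'a set" where
  "adjoin v S = S \<union> (\<lambda>s. v \<oplus> s) ` S"

lemma subgrp_adjoin:
  assumes S: "subgrp S" and v: "v \<in> G"
  shows "subgrp (adjoin v S)"
proof -
  have SG: "x \<in> G" if "x \<in> S" for x
    using S that by (auto simp: subgrp_def)
  have cl: "x \<oplus> y \<in> S" if "x \<in> S" "y \<in> S" for x y
    using S that by (auto simp: subgrp_def)
  have "x \<oplus> (v \<oplus> y) = v \<oplus> (x \<oplus> y)" if "x \<in> S" "y \<in> S" for x y
    using that v SG by (metis add_assoc add_commute)
  moreover have "(v \<oplus> x) \<oplus> (v \<oplus> y) = x \<oplus> y" if "x \<in> S" "y \<in> S" for x y
    using that v SG by (metis add_assoc add_cancel add_closed add_commute)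
  ultimately show ?thesis
    using S v SG cl unfolding subgrp_def adjoin_def by (auto simp: add_assoc)
qed

lemma card_adjoin:
  assumes S: "subgrp S" and v: "v \<in> G" "v \<notin> S"
  shows "card (adjoin v S) = 2 * card S"
proof -
  have SG: "x \<in> G" if "x \<in> S" for x
    using S that by (auto simp: subgrp_def)
  have fin: "finite S"
    using S finite_subset[OF _ finite_G] by (auto simp: subgrp_def)
  have "inj_on (\<lambda>s. v \<oplus> s) S"
    by (rule inj_on_inverseI[where g = "\<lambda>s. s \<oplus> v"]) (metis SG v(1) add_cancel add_commute)
  moreover have "S \<inter> (\<lambda>s. v \<oplus> s) ` S = {}"
  proof -
    have False if "s \<in> S" "v \<oplus> s \<in> S" for s
      using that S v SG by (metis add_cancel subgrp_def)
    then show ?thesis by auto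
  qed
  ultimately show ?thesis
    using fin by (simp add: adjoin_def card_Un_disjoint card_image)
qed

end

text \<open>On words, \<open>wchar x x\<close> can be \<open>- 1\<close>; the form on Pauli labels
  is alternating. This is what allows any element of \<open>perp S\<close> to be adjoined to an
  isotropic \<open>S\<close>.\<close>

locale symplectic_group = bicharacter_group +
  assumes omega_self: "x \<in> G \<Longrightarrow> \<omega> x x = 1"
begin

lemma perp_adjoin:
  "\<lbrakk>S \<subseteq> G; v \<in> G; \<zero> \<in> S\<rbrakk> \<Longrightarrow> perp (adjoin v S) = {x \<in> perp S. \<omega> x v = 1}"
  by (auto simp: perp_def adjoin_def omega_add_right subset_iff ball_Un)

lemma isotropic_adjoin:
  assumes S: "subgrp S" "S \<subseteq> perp S" and v: "v \<in> perp S"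
  shows "adjoin v S \<subseteq> perp (adjoin v S)"
proof -
  have SG: "S \<subseteq> G" "\<zero> \<in> S" "v \<in> G" "\<And>s. s \<in> S \<Longrightarrow> s \<in> G"
    using S v by (auto simp: subgrp_def perp_def)
  have "\<omega> v s = 1" "\<omega> s v = 1" if "s \<in> S" for s
    using v that SG by (auto simp: perp_def omega_sym)
  moreover have "\<omega> s s' = 1" if "s \<in> S" "s' \<in> S" for s s'
    using that S by (auto simp: perp_def)
  ultimately show ?thesis
    using SG unfolding adjoin_def perp_def
    by (auto simp: omega_add omega_add_right omega_self)
qed

text \<open>A sum over \<open>v \<in> perp S - S\<close> of \<open>\<omega> e v\<close> equals \<open>- card S\<close>, so on average \<open>v\<close> is orthogonal to at
  most half of the elements of \<open>B\<close>.\<close>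

lemma ex_halving:
  assumes S: "subgrp S" "S \<subseteq> perp S" and ne: "perp S \<noteq> S"
    and B: "B \<subseteq> perp S - S"
  shows "\<exists>v\<in>perp S - S. 2 * card {e \<in> B. \<omega> e v = 1} \<le> card B"
proof (rule ccontr)
  assume contr: "\<not> ?thesis"
  have fin: "finite (perp S)" by (auto simp: perp_def)
  then have finB: "finite B" and finS: "finite S"
    using B S(2) finite_subset[of B] finite_subset[of S "perp S"] by auto
  have SG: "S \<subseteq> G" using S by (auto simp: subgrp_def)
  have PG: "x \<in> G" if "x \<in> perp S" for x using that by (auto simp: perp_def)
  \<comment> \<open>The negated claim says that more than half of the signs
    \<open>\<omega> e v\<close> with \<open>e \<in> B\<close> are \<open>1\<close>.\<close>
  have pos: "(\<Sum>e\<in>B. \<omega> e v) > 0" if v: "v \<in> perp S - S" for v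
  proof -
    have "(\<Sum>e\<in>B. \<omega> e v) = (\<Sum>e\<in>B. 2 * of_bool (\<omega> e v = 1) - 1)"
    proof (intro sum.cong refl)
      fix e assume "e \<in> B"
      then have "\<omega> e v = 1 \<or> \<omega> e v = - 1"
        using B v PG by (intro omega_cases) auto
      then show "\<omega> e v = 2 * of_bool (\<omega> e v = 1) - 1" by auto
    qed
    also have "\<dots> = 2 * (\<Sum>e\<in>B. of_bool (\<omega> e v = 1)) - int (card B)"
      by (simp add: sum_subtractf sum_distrib_left)
    also have "(\<Sum>e\<in>B. of_bool (\<omega> e v = 1)) = int (card {e \<in> B. \<omega> e v = 1})"
      using finB by (simp add: Int_def)
    finally show ?thesis using contr v by force
  qed
  have "(\<Sum>v\<in>perp S - S. \<Sum>e\<in>B. \<omega> e v) > 0"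
  proof (rule sum_pos)
    show "perp S - S \<noteq> {}" using ne S(2) by blast
  qed (use pos fin in auto)
  also have "(\<Sum>v\<in>perp S - S. \<Sum>e\<in>B. \<omega> e v) = (\<Sum>e\<in>B. \<Sum>v\<in>perp S - S. \<omega> e v)"
    by (rule sum.swap)
  also have "\<dots> = (\<Sum>e\<in>B. - int (card S))"
  proof (intro sum.cong refl)
    fix e assume e: "e \<in> B"
    \<comment> \<open>Since \<open>e\<close> is outside \<open>S = perp (perp S)\<close>, its sum
      over \<open>perp S\<close> vanishes; since \<open>e \<in> perp S\<close>, its sum over
      \<open>S\<close> is \<open>card S\<close>.\<close>
    then have eP: "e \<in> perp S" "e \<notin> perp (perp S)" "e \<in> G"
      using B PG perp_perp[OF S(1)] by auto
    have "(\<Sum>v\<in>perp S - S. \<omega> e v) = (\<Sum>v\<in>perp S. \<omega> e v) - (\<Sum>v\<in>S. \<omega> e v)"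
      using fin S(2) by (rule sum_diff)
    also have "\<dots> = - int (card S)"
      using eP by (simp add: sum_omega_subgrp S(1) subgrp_perp SG)
    finally show "(\<Sum>v\<in>perp S - S. \<omega> e v) = - int (card S)" .
  qed
  finally show False by (simp add: mult_less_0_iff)
qed

end


section \<open>Generalized Pauli operators\<close>

lemma prod_sign_cases:
  fixes f :: "'a \<Rightarrow> int"
  assumes "\<And>x. x \<in> A \<Longrightarrow> f x = 1 \<or> f x = - 1"
  shows "prod f A = 1 \<or> prod f A = - 1"
  using assms
proof (induction A rule: infinite_finite_induct)
  case (insert x F)
  then have "f x = 1 \<or> f x = - 1" "prod f F = 1 \<or> prod f F = - 1" by blast+
  with insert.hyps show ?case by auto
qed auto

lemma xor_nat_less: "xor a b < 2 ^ r" if "a < 2 ^ r" "b < 2 ^ r" for a b :: nat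
  using that by (metis take_bit_nat_eq_self_iff take_bit_xor)

text \<open>Letters below \<open>2 ^ r\<close> are read as strings of \<open>r\<close> bits and
  added by \<open>xor\<close>, so that words of length \<open>N\<close> form a binary vector space
  of dimension \<open>r * N\<close>.\<close>

locale qudits =
  fixes r N :: nat
begin

abbreviation W :: "(nat \<Rightarrow> nat) set" where
  "W \<equiv> words (2 ^ r) N"

text \<open>The restriction makes the value \<open>undefined\<close> from position \<open>N\<close>
  on, as membership in \<open>words\<close> demands.\<close>

definition wadd :: "(nat \<Rightarrow> nat) \<Rightarrow> (nat \<Rightarrow> nat) \<Rightarrow> nat \<Rightarrow> nat" where
  "wadd x y = (\<lambda>i\<in>{..<N}. xor (x i) (y i))"

definition wzero :: "nat \<Rightarrow> nat" where
  "wzero = (\<lambda>i\<in>{..<N}. 0)"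

definition wunit :: "nat \<Rightarrow> nat \<Rightarrow> nat \<Rightarrow> nat" where
  "wunit i j = (\<lambda>i'\<in>{..<N}. if i' = i then 2 ^ j else 0)"

text \<open>This is \<open>- 1\<close> to the power of the dot product of the two words, taken over
  all \<open>r * N\<close> bits.\<close>

definition wchar :: "(nat \<Rightarrow> nat) \<Rightarrow> (nat \<Rightarrow> nat) \<Rightarrow> int" where
  "wchar x y = (\<Prod>i<N. \<Prod>j<r. if bit (x i) j \<and> bit (y i) j then - 1 else 1)"

lemma words_less: "x \<in> W \<Longrightarrow> i < N \<Longrightarrow> x i < 2 ^ r"
  by (auto simp: words_def)

lemma words_eqI: "x \<in> W \<Longrightarrow> y \<in> W \<Longrightarrow> (\<And>i. i < N \<Longrightarrow> x i = y i) \<Longrightarrow> x = y"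
  unfolding words_def by (rule PiE_ext) auto

lemma finite_W [simp]: "finite W"
  unfolding words_def by (intro finite_PiE) auto

lemma card_W: "card W = 2 ^ (r * N)"
  by (simp add: words_def card_PiE power_mult)

lemma wchar_add:
  "wchar (wadd x y) z = wchar x z * wchar y z"
  unfolding wchar_def prod.distrib[symmetric]
  by (intro prod.cong refl) (auto simp: wadd_def bit_xor_iff)

lemma wchar_sym: "wchar x y = wchar y x"
  unfolding wchar_def by (intro prod.cong refl) auto

lemma wunit_in_W: "j < r \<Longrightarrow> wunit i j \<in> W"
  by (auto simp: words_def wunit_def)

text \<open>Only the factor at position \<open>i\<close> and bit \<open>j\<close> can differ from
  \<open>1\<close>. Pairing with unit words thus reads off single bits, which gives
  nondegeneracy.\<close>

lemma wchar_wunit: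
  assumes "i < N" "j < r"
  shows "wchar x (wunit i j) = (if bit (x i) j then - 1 else 1)"
proof -
  have inner: "(\<Prod>j'<r. if bit (x i) j' \<and> j' = j then - 1 else 1 :: int) =
      (if bit (x i) j then - 1 else 1)"
  proof -
    have "(\<Prod>j'<r. if bit (x i) j' \<and> j' = j then - 1 else 1 :: int) =
        (\<Prod>j'<r. if j' = j then if bit (x i) j then - 1 else 1 else 1)"
      by (intro prod.cong refl) auto
    then show ?thesis using assms by simp
  qed
  have "wchar x (wunit i j) =
      (\<Prod>i'<N. if i' = i then \<Prod>j'<r. if bit (x i) j' \<and> j' = j then - 1 else 1 else 1)"
    unfolding wchar_def
    by (intro prod.cong refl) (auto simp: wunit_def bit_exp_iff intro!: prod.cong)
  also have "\<dots> = (if bit (x i) j then - 1 else 1)"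
    unfolding inner using assms by simp
  finally show ?thesis .
qed

lemma ex_bit:
  assumes "x \<in> W" "i < N" "x i \<noteq> 0"
  obtains j where "j < r" "bit (x i) j"
proof -
  obtain j where j: "bit (x i) j"
    using assms(3) by (metis bit_0_eq bot_apply bot_bool_def bit_eqI)
  have "take_bit r (x i) = x i"
    using words_less[OF assms(1,2)] by (simp add: take_bit_nat_eq_self_iff)
  then have "j < r"
    using j by (metis bit_take_bit_iff)
  then show thesis using that j by blast
qed

sublocale bicharacter_group W wadd wzero wchar
proof unfold_locales
  fix x y z
  show "finite W" by simp
  show "wadd x y \<in> W" if "x \<in> W" "y \<in> W"
    using that by (auto simp: words_def wadd_def intro!: xor_nat_less)
  show "wzero \<in> W" by (auto simp: words_def wzero_def)
  show "wadd (wadd x y) z = wadd x (wadd y z)"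
    by (auto simp: wadd_def fun_eq_iff xor.assoc)
  show "wadd x y = wadd y x"
    by (auto simp: wadd_def fun_eq_iff xor.commute)
  show "wadd x wzero = x" if "x \<in> W"
    using that by (auto simp: wadd_def wzero_def words_def fun_eq_iff PiE_def extensional_def)
  show "wadd x x = wzero"
    by (auto simp: wadd_def wzero_def fun_eq_iff)
  show "wchar x y = 1 \<or> wchar x y = - 1"
    unfolding wchar_def by (intro prod_sign_cases) auto
  show "wchar (wadd x y) z = wchar x z * wchar y z" by (rule wchar_add)
  show "wchar x y = wchar y x" by (rule wchar_sym)
  show "\<exists>y\<in>W. wchar x y = - 1" if xW: "x \<in> W" "x \<noteq> wzero"
  proof -
    obtain i where "i < N" "x i \<noteq> 0"
      using xW by (auto simp: wzero_def words_def fun_eq_iff PiE_def extensional_def split: if_splits)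
    then obtain j where "j < r" "bit (x i) j"
      using ex_bit xW by blast
    then show ?thesis
      using \<open>i < N\<close> wunit_in_W wchar_wunit by (metis (full_types))
  qed
qed

text \<open>A pair \<open>(a, b)\<close> labels the Pauli operator that shifts by \<open>a\<close>
  and multiplies by the character of \<open>b\<close>. Labels ignore phases.\<close>

definition padd where
  "padd p p' = (wadd (fst p) (fst p'), wadd (snd p) (snd p'))"

text \<open>The standard symplectic form in multiplicative notation: the sign that appears when two
  Pauli operators are interchanged.\<close>

definition pform where
  "pform p p' = wchar (snd p) (fst p') * wchar (snd p') (fst p)"

sublocale pauli: symplectic_group "W \<times> W" padd "(wzero, wzero)" pform
proof unfold_locales
  fix x y z :: "(nat \<Rightarrow> nat) \<times> (nat \<Rightarrow> nat)"
  show "finite (W \<times> W)" by simp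
  show "padd x y \<in> W \<times> W" if "x \<in> W \<times> W" "y \<in> W \<times> W"
    using that by (auto simp: padd_def)
  show "(wzero, wzero) \<in> W \<times> W" by simp
  show "padd (padd x y) z = padd x (padd y z)" if "x \<in> W \<times> W" "y \<in> W \<times> W" "z \<in> W \<times> W"
    using that by (auto simp: padd_def add_assoc)
  show "padd x y = padd y x" if "x \<in> W \<times> W" "y \<in> W \<times> W"
    using that by (auto simp: padd_def add_commute)
  show "padd x (wzero, wzero) = x" if "x \<in> W \<times> W"
    using that by (auto simp: padd_def)
  show "padd x x = (wzero, wzero)" if "x \<in> W \<times> W"
    using that by (auto simp: padd_def)
  show "pform x y = 1 \<or> pform x y = - 1" if "x \<in> W \<times> W" "y \<in> W \<times> W"
    using that omega_cases[of "snd x" "fst y"] omega_cases[of "snd y" "fst x"]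
    by (auto simp: pform_def)
  show "pform (padd x y) z = pform x z * pform y z"
    if "x \<in> W \<times> W" "y \<in> W \<times> W" "z \<in> W \<times> W"
    using that by (auto simp: pform_def padd_def omega_add omega_add_right)
  show "pform x y = pform y x"
    by (simp add: pform_def)
  show "\<exists>y\<in>W \<times> W. pform x y = - 1" if xW: "x \<in> W \<times> W" "x \<noteq> (wzero, wzero)"
  proof -
    obtain a b where x: "x = (a, b)" "a \<in> W" "b \<in> W" using xW(1) by blast
    consider "a \<noteq> wzero" | "b \<noteq> wzero" using xW(2) x by blast
    then show ?thesis
    proof cases
      case 1
      then obtain y where "y \<in> W" "wchar a y = - 1" using omega_nondegenerate x by blast
      then have "pform x (wzero, y) = - 1" using x by (simp add: pform_def wchar_sym)
      then show ?thesis using \<open>y \<in> W\<close> by (intro bexI[of _ "(wzero, y)"]) auto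
    next
      case 2
      then obtain y where "y \<in> W" "wchar b y = - 1" using omega_nondegenerate x by blast
      then have "pform x (y, wzero) = - 1" using x by (simp add: pform_def)
      then show ?thesis using \<open>y \<in> W\<close> by (intro bexI[of _ "(y, wzero)"]) auto
    qed
  qed
  show "pform x x = 1" if "x \<in> W \<times> W"
    using that by (auto simp: pform_def)
qed

definition pauli_op :: "(nat \<Rightarrow> nat) \<times> (nat \<Rightarrow> nat) \<Rightarrow> qvec \<Rightarrow> qvec" where
  "pauli_op p u =
     (\<lambda>x. if x \<in> W then of_int (wchar (snd p) x) * u (wadd x (fst p)) else 0)"

lemma pauli_op_in_qspace: "pauli_op p u \<in> qspace (2 ^ r) N"
  by (simp add: qspace_def pauli_op_def)

text \<open>The sign arises from moving the character of \<open>p'\<close> past the shift of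
  \<open>p\<close>.\<close>

lemma pauli_op_pauli_op:
  assumes "p \<in> W \<times> W" "p' \<in> W \<times> W"
  shows "pauli_op p (pauli_op p' u) =
    qscale (of_int (wchar (snd p') (fst p))) (pauli_op (padd p p') u)"
  using assms
  by (auto simp: fun_eq_iff pauli_op_def qscale_def padd_def omega_add omega_add_right add_assoc)

lemma pauli_op_commute:
  assumes "p \<in> W \<times> W" "p' \<in> W \<times> W"
  shows "pauli_op p (pauli_op p' u) = qscale (of_int (pform p p')) (pauli_op p' (pauli_op p u))"
proof -
  have "wchar (snd p) (fst p') * (wchar (snd p) (fst p') * z) = z" for z
    using assms by (simp add: mult.assoc[symmetric] mem_Times_iff)
  then have "of_int (wchar (snd p) (fst p')) * (of_int (wchar (snd p) (fst p')) * z) = z"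
    for z :: complex
    using assms by (simp add: mult.assoc[symmetric] mem_Times_iff flip: of_int_mult)
  then show ?thesis
    using assms
    by (simp add: pauli_op_pauli_op pform_def pauli.add_commute[of p' p] qscale_def fun_eq_iff mult_ac)
qed

text \<open>Shifting twice restores the word, and the two character values met on the way differ by
  a constant sign. Hence the only possible eigenvalues are the square roots of that sign.\<close>

lemma pauli_op_square:
  assumes "p \<in> W \<times> W" "u \<in> qspace (2 ^ r) N"
  shows "pauli_op p (pauli_op p u) = qscale (of_int (wchar (snd p) (fst p))) u"
proof -
  have "wchar (snd p) x * wchar (snd p) (wadd x (fst p)) = wchar (snd p) (fst p)" if "x \<in> W" for x
    using assms(1) that by (simp add: omega_add_right mem_Times_iff mult.assoc[symmetric])
  then have "of_int (wchar (snd p) x) * (of_int (wchar (snd p) (wadd x (fst p))) * z) =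
      of_int (wchar (snd p) (fst p)) * z" if "x \<in> W" for x and z :: complex
    using that by (simp add: mult.assoc[symmetric] flip: of_int_mult)
  then show ?thesis
    using assms by (auto simp: fun_eq_iff qscale_def pauli_op_def qspace_def mem_Times_iff)
qed

lemma pauli_op_zero: "u \<in> qspace (2 ^ r) N \<Longrightarrow> pauli_op (wzero, wzero) u = u"
  by (auto simp: fun_eq_iff pauli_op_def qspace_def)

lemma pauli_op_add: "pauli_op p (u + v) = pauli_op p u + pauli_op p v"
  by (auto simp: pauli_op_def fun_eq_iff algebra_simps)

lemma pauli_op_scale: "pauli_op p (qscale c u) = qscale c (pauli_op p u)"
  by (auto simp: pauli_op_def fun_eq_iff qscale_def)

text \<open>Unitarity: the shift permutes the words and the real signs square to
  \<open>1\<close>.\<close>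

lemma qinner_pauli_op:
  assumes "p \<in> W \<times> W"
  shows "qinner (2 ^ r) N (pauli_op p u) (pauli_op p v) = qinner (2 ^ r) N u v"
  unfolding qinner_def
proof (rule sum.reindex_bij_witness[where i = "\<lambda>x. wadd x (fst p)" and j = "\<lambda>x. wadd x (fst p)"])
  fix x assume x: "x \<in> W"
  have "of_int (wchar (snd p) x) * (of_int (wchar (snd p) x) * z) = z" for z :: complex
    using assms x by (simp add: mult.assoc[symmetric] mem_Times_iff flip: of_int_mult)
  then show "cnj (u (wadd x (fst p))) * v (wadd x (fst p)) =
      cnj (pauli_op p u x) * pauli_op p v x"
    using x by (simp add: pauli_op_def mult_ac)
qed (use assms in auto)


section \<open>Stabilizer codes\<close>

lemma pauli_op_zero_vec [simp]: "pauli_op p 0 = 0"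
  by (auto simp: pauli_op_def fun_eq_iff)

lemma subspace_qspace: "qvec.subspace (qspace (2 ^ r) N)"
  by (auto simp: qvec.subspace_def qspace_def qscale_def)

section \<open>The standard basis of the state space\<close>

definition delta :: "(nat \<Rightarrow> nat) \<Rightarrow> qvec" where
  "delta x = (\<lambda>y. if y = x then 1 else 0)"

lemma inj_delta: "inj_on delta A"
  by (rule inj_onI) (metis delta_def zero_neq_one)

lemma sum_delta:
  "finite A \<Longrightarrow> (\<Sum>x\<in>A. qscale (f x) (delta x)) = (\<lambda>y. if y \<in> A then f y else 0)"
proof (induction A rule: finite_induct)
  case (insert x A)
  then show ?case
    by (intro ext) (auto simp: qscale_def delta_def)
qed (simp add: zero_fun_def)

lemma independent_delta: "qvec.independent (delta ` W)"
proof
  assume "qvec.dependent (delta ` W)"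
  then obtain f v where v: "v \<in> delta ` W" "f v \<noteq> 0" "(\<Sum>w\<in>delta ` W. qscale (f w) w) = 0"
    using qvec.dependent_finite[OF finite_imageI[OF finite_W]] by blast
  then obtain x where x: "x \<in> W" "v = delta x" by auto
  have "(\<Sum>y\<in>W. qscale (f (delta y)) (delta y)) = 0"
    using v(3) by (simp add: sum.reindex inj_delta)
  then have "(\<lambda>y. if y \<in> W then f (delta y) else 0) = 0"
    by (simp add: sum_delta)
  then have "(if x \<in> W then f (delta x) else 0) = 0"
    by (rule fun_cong[where x = x, THEN trans]) (simp add: zero_fun_def)
  then show False
    using x v(2) by simp
qed

lemma qspace_subset_span: "qspace (2 ^ r) N \<subseteq> qvec.span (delta ` W)"
proof
  fix u assume "u \<in> qspace (2 ^ r) N"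
  then have "u = (\<Sum>x\<in>W. qscale (u x) (delta x))"
    by (auto simp: sum_delta fun_eq_iff qspace_def)
  also have "\<dots> \<in> qvec.span (delta ` W)"
    by (intro qvec.span_sum qvec.span_scale qvec.span_base) auto
  finally show "u \<in> qvec.span (delta ` W)" .
qed

lemma dim_qspace: "qvec.dim (qspace (2 ^ r) N) = 2 ^ (r * N)"
proof (rule qvec.dim_unique)
  show "delta ` W \<subseteq> qspace (2 ^ r) N"
    by (auto simp: qspace_def delta_def)
qed (auto simp: qspace_subset_span independent_delta card_image inj_delta card_W)

lemma finite_independent:
  "qvec.independent B \<Longrightarrow> B \<subseteq> qspace (2 ^ r) N \<Longrightarrow> finite B"
  using qvec.independent_span_bound[of "delta ` W" B] qspace_subset_span by auto

text \<open>Elements of \<open>S\<close> act by scalars of modulus one instead of the usual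
  \<open>1\<close>, so no phases have to be tracked. Invariance under \<open>perp S\<close> is what
  lets a further operator from \<open>perp S\<close> split \<open>C\<close> into
  eigenspaces.\<close>

definition stabilizes :: "((nat \<Rightarrow> nat) \<times> (nat \<Rightarrow> nat)) set \<Rightarrow> qvec set \<Rightarrow> bool" where
  "stabilizes S C \<longleftrightarrow> qvec.subspace C \<and> C \<subseteq> qspace (2 ^ r) N \<and>
     (\<forall>s\<in>S. \<exists>c. cnj c * c = 1 \<and> (\<forall>u\<in>C. pauli_op s u = qscale c u)) \<and>
     (\<forall>t\<in>pauli.perp S. \<forall>u\<in>C. pauli_op t u \<in> C)"

lemma stabilizes_zero: "stabilizes {(wzero, wzero)} (qspace (2 ^ r) N)"
proof -
  have "\<exists>c. cnj c * c = 1 \<and> (\<forall>u\<in>qspace (2 ^ r) N. pauli_op (wzero, wzero) u = qscale c u)"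
    by (rule exI[of _ 1]) (auto simp: pauli_op_zero)
  then show ?thesis
    by (auto simp: stabilizes_def subspace_qspace pauli_op_in_qspace)
qed

definition eigenspace :: "qvec set \<Rightarrow> (nat \<Rightarrow> nat) \<times> (nat \<Rightarrow> nat) \<Rightarrow> complex \<Rightarrow> qvec set" where
  "eigenspace C v c = {u \<in> C. pauli_op v u = qscale c u}"

lemma subspace_eigenspace: "qvec.subspace C \<Longrightarrow> qvec.subspace (eigenspace C v c)"
  by (auto simp: qvec.subspace_def eigenspace_def pauli_op_add pauli_op_scale
      qvec.scale_right_distrib mult.commute)

text \<open>Up to a sign, a new element \<open>padd v t\<close> acts as the product of the operators
  of \<open>v\<close> and \<open>t\<close>, both scalar on the eigenspace. Operators in the new
  complement commute with that of \<open>v\<close> and hence preserve its eigenspaces.\<close>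

lemma stabilizes_eigenspace:
  assumes S: "pauli.subgrp S" and v: "v \<in> pauli.perp S" and C: "stabilizes S C"
    and c: "cnj c * c = 1"
  shows "stabilizes (pauli.adjoin v S) (eigenspace C v c)"
proof -
  have vG: "v \<in> W \<times> W" using v unfolding pauli.perp_def by blast
  have SG: "S \<subseteq> W \<times> W" "(wzero, wzero) \<in> S" using S unfolding pauli.subgrp_def by blast+
  have "\<exists>c'. cnj c' * c' = 1 \<and> (\<forall>u\<in>eigenspace C v c. pauli_op s u = qscale c' u)"
    if "s \<in> pauli.adjoin v S" for s
    using that unfolding pauli.adjoin_def
  proof
    assume "s \<in> S"
    then show ?thesis using C unfolding stabilizes_def eigenspace_def by blast
  next
    assume "s \<in> padd v ` S"
    then obtain t where t: "t \<in> S" "s = padd v t" by blast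
    obtain d where d: "cnj d * d = 1" "\<And>u. u \<in> C \<Longrightarrow> pauli_op t u = qscale d u"
      using C t(1) unfolding stabilizes_def by blast
    define \<epsilon> :: complex where "\<epsilon> = of_int (wchar (snd t) (fst v))"
    have tG: "t \<in> W \<times> W" using SG t by blast
    then have \<epsilon>: "\<epsilon> * \<epsilon> = 1" "cnj \<epsilon> = \<epsilon>"
      using vG unfolding \<epsilon>_def by (auto simp: mem_Times_iff simp flip: of_int_mult)
    have "pauli_op s u = qscale (\<epsilon> * d * c) u" if "u \<in> eigenspace C v c" for u
    proof -
      have u: "u \<in> C" "pauli_op v u = qscale c u" using that by (auto simp: eigenspace_def)
      have "qscale \<epsilon> (pauli_op s u) = pauli_op v (pauli_op t u)"
        using pauli_op_pauli_op[OF vG tG] by (simp add: t(2) \<epsilon>_def)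
      also have "\<dots> = qscale (d * c) u"
        using u d(2) by (simp add: pauli_op_scale)
      finally have "qscale \<epsilon> (qscale \<epsilon> (pauli_op s u)) = qscale \<epsilon> (qscale (d * c) u)"
        by simp
      then show ?thesis using \<epsilon> by (simp add: mult.assoc)
    qed
    moreover have "cnj (\<epsilon> * d * c) * (\<epsilon> * d * c) = 1"
    proof -
      have "cnj (\<epsilon> * d * c) * (\<epsilon> * d * c) = (\<epsilon> * \<epsilon>) * (cnj d * d) * (cnj c * c)"
        by (simp add: \<epsilon> mult_ac)
      then show ?thesis using \<epsilon> d c by simp
    qed
    ultimately show ?thesis by blast
  qed
  moreover have "pauli_op t u \<in> eigenspace C v c"
    if t: "t \<in> pauli.perp (pauli.adjoin v S)" and u: "u \<in> eigenspace C v c" for t u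
  proof -
    have tv: "t \<in> pauli.perp S" "pform t v = 1"
      using t pauli.perp_adjoin[OF SG(1) vG SG(2)] by auto
    then have tG: "t \<in> W \<times> W" unfolding pauli.perp_def by blast
    have "pform v t = 1"
      using tv(2) by (simp add: pform_def mult.commute)
    then have "pauli_op v (pauli_op t u) = qscale c (pauli_op t u)"
      using u pauli_op_commute[OF vG tG, of u] by (simp add: eigenspace_def pauli_op_scale)
    moreover have "pauli_op t u \<in> C"
      using u tv(1) C unfolding stabilizes_def eigenspace_def by blast
    ultimately show ?thesis by (simp add: eigenspace_def)
  qed
  moreover have "qvec.subspace (eigenspace C v c)"
    using C by (auto simp: stabilizes_def subspace_eigenspace)
  moreover have "eigenspace C v c \<subseteq> qspace (2 ^ r) N"
    using C by (auto simp: stabilizes_def eigenspace_def)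
  ultimately show ?thesis
    unfolding stabilizes_def by blast
qed

text \<open>With \<open>V\<close> the operator of \<open>v\<close>, so that \<open>V\<close> squares
  to \<open>c * c\<close>, every \<open>u\<close> is half the sum of \<open>u + V u / c\<close> and
  \<open>u - V u / c\<close>, which are eigenvectors for \<open>c\<close> and \<open>- c\<close>. So
  bases of the two eigenspaces together span \<open>C\<close>.\<close>

lemma dim_eigenspaces:
  assumes C: "qvec.subspace C" "C \<subseteq> qspace (2 ^ r) N" and v: "v \<in> W \<times> W"
    and inv: "\<And>u. u \<in> C \<Longrightarrow> pauli_op v u \<in> C"
    and c: "c * c = of_int (wchar (snd v) (fst v))" "c \<noteq> 0"
  shows "qvec.dim C \<le> qvec.dim (eigenspace C v c) + qvec.dim (eigenspace C v (- c))"
proof -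
  let ?E = "eigenspace C v"
  obtain A where A: "A \<subseteq> ?E c" "qvec.independent A" "?E c \<subseteq> qvec.span A" "card A = qvec.dim (?E c)"
    using qvec.basis_exists by blast
  obtain B where B: "B \<subseteq> ?E (- c)" "qvec.independent B" "?E (- c) \<subseteq> qvec.span B"
    "card B = qvec.dim (?E (- c))"
    using qvec.basis_exists by blast
  have fin: "finite A" "finite B"
  proof -
    have "?E d \<subseteq> qspace (2 ^ r) N" for d
      using C(2) by (auto simp: eigenspace_def)
    then show "finite A" "finite B"
      using A(1,2) B(1,2) finite_independent by (meson order.trans)+
  qed
  have "C \<subseteq> qvec.span (A \<union> B)"
  proof
    fix u assume u: "u \<in> C"
    have *: "qscale (1 / 2) (u + qscale (1 / d) (pauli_op v u)) \<in> ?E d"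
      if d: "d * d = of_int (wchar (snd v) (fst v))" "d \<noteq> 0" for d
    proof -
      have "pauli_op v (pauli_op v u) = qscale (d * d) u"
        using d u C v by (auto simp: pauli_op_square)
      then have "pauli_op v (qscale (1 / 2) (u + qscale (1 / d) (pauli_op v u))) =
          qscale d (qscale (1 / 2) (u + qscale (1 / d) (pauli_op v u)))"
        using d(2) by (simp add: pauli_op_scale pauli_op_add qvec.scale_right_distrib add.commute)
      then show ?thesis
        using u inv C by (simp add: eigenspace_def qvec.subspace_add qvec.subspace_scale)
    qed
    have "qscale (1 / 2) (u + qscale (1 / c) (pauli_op v u)) \<in> qvec.span (A \<union> B)"
      using *[OF c] A(3) qvec.span_mono[of A "A \<union> B"] by blast
    moreover have "qscale (1 / 2) (u + qscale (1 / (- c)) (pauli_op v u)) \<in> qvec.span (A \<union> B)"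
    proof -
      have "qscale (1 / 2) (u + qscale (1 / (- c)) (pauli_op v u)) \<in> ?E (- c)"
        by (rule *) (use c in simp_all)
      then show ?thesis
        using B(3) qvec.span_mono[of B "A \<union> B"] by blast
    qed
    ultimately have "qscale (1 / 2) (u + qscale (1 / c) (pauli_op v u)) +
        qscale (1 / 2) (u + qscale (1 / (- c)) (pauli_op v u)) \<in> qvec.span (A \<union> B)"
      by (rule qvec.span_add)
    also have "qscale (1 / 2) (u + qscale (1 / c) (pauli_op v u)) +
        qscale (1 / 2) (u + qscale (1 / (- c)) (pauli_op v u)) = u"
      by (intro ext) (simp add: qscale_def algebra_simps)
    finally show "u \<in> qvec.span (A \<union> B)" .
  qed
  then have "qvec.dim C \<le> card (A \<union> B)"
    using fin by (intro qvec.dim_le_card) auto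
  also have "\<dots> \<le> card A + card B"
    by (rule card_Un_le)
  finally show ?thesis using A B by simp
qed

text \<open>The larger of the two eigenspaces has at least half the dimension. This lower bound
  suffices, so exact dimensions of stabilizer spaces are never computed.\<close>

lemma stabilizes_adjoin:
  assumes S: "pauli.subgrp S" and v: "v \<in> pauli.perp S" and C: "stabilizes S C"
  obtains C' where "stabilizes (pauli.adjoin v S) C'" "qvec.dim C \<le> 2 * qvec.dim C'"
proof -
  have vG: "v \<in> W \<times> W" using v unfolding pauli.perp_def by blast
  \<comment> \<open>A square root of the sign by which the operator of \<open>v\<close> squares:
    \<open>\<i>\<close> is needed when that sign is \<open>- 1\<close>.\<close>
  define c :: complex where "c = (if wchar (snd v) (fst v) = 1 then 1 else \<i>)"
  have c: "c * c = of_int (wchar (snd v) (fst v))" "cnj c * c = 1" "c \<noteq> 0"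
    using omega_cases[of "snd v" "fst v"] vG by (auto simp: c_def mem_Times_iff)
  have "qvec.dim C \<le> qvec.dim (eigenspace C v c) + qvec.dim (eigenspace C v (- c))"
    using C v vG c by (intro dim_eigenspaces) (auto simp: stabilizes_def)
  moreover have "stabilizes (pauli.adjoin v S) (eigenspace C v c)"
    "stabilizes (pauli.adjoin v S) (eigenspace C v (- c))"
    using c by (intro stabilizes_eigenspace[OF S v C]; simp)+
  ultimately show thesis
    using that[of "eigenspace C v c"] that[of "eigenspace C v (- c)"] by linarith
qed

text \<open>Starting from the trivial group, each of the \<open>j\<close> rounds adjoins a vector
  given by \<open>ex_halving\<close>. It at least halves the part of \<open>L\<close> in
  \<open>perp S - S\<close> and at worst halves the dimension of \<open>C\<close>.\<close>

lemma ex_stabilizer_code: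
  assumes "L \<subseteq> W \<times> W" "j \<le> r * N"
  shows "\<exists>S C. pauli.subgrp S \<and> S \<subseteq> pauli.perp S \<and> card S = 2 ^ j \<and>
    2 ^ j * card (L \<inter> (pauli.perp S - S)) \<le> card L \<and>
    stabilizes S C \<and> 2 ^ (r * N) \<le> 2 ^ j * qvec.dim C"
  using assms(2)
proof (induction j)
  case 0
  let ?S = "{(wzero, wzero)}"
  have "finite L" using assms(1) finite_subset by fastforce
  then have "card (L \<inter> (pauli.perp ?S - ?S)) \<le> card L"
    by (intro card_mono) auto
  moreover have "pauli.subgrp ?S" "?S \<subseteq> pauli.perp ?S"
    by (auto simp: pauli.subgrp_def pauli.perp_def padd_def pform_def)
  ultimately show ?case
    using stabilizes_zero dim_qspace
    by (intro exI[of _ ?S] exI[of _ "qspace (2 ^ r) N"]) auto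
next
  case (Suc j)
  then obtain S C where S: "pauli.subgrp S" "S \<subseteq> pauli.perp S" "card S = 2 ^ j"
    and L: "2 ^ j * card (L \<inter> (pauli.perp S - S)) \<le> card L"
    and C: "stabilizes S C" "2 ^ (r * N) \<le> 2 ^ j * qvec.dim C"
    by auto
  \<comment> \<open>There is room to extend: a self-dual \<open>S\<close> would have
    \<open>2 ^ (r * N)\<close> elements, but \<open>j < r * N\<close>.\<close>
  have "pauli.perp S \<noteq> S"
  proof
    assume "pauli.perp S = S"
    then have "2 ^ (j + j) = (2 :: nat) ^ (r * N + r * N)"
      using pauli.card_perp[OF S(1)] S(3) by (simp add: power_add card_cartesian_product card_W)
    then have "j + j = r * N + r * N"
      by (subst (asm) power_inject_exp) auto
    then show False using Suc.prems by simp
  qed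
  then obtain v where v: "v \<in> pauli.perp S - S"
    "2 * card {e \<in> L \<inter> (pauli.perp S - S). pform e v = 1} \<le> card (L \<inter> (pauli.perp S - S))"
    using pauli.ex_halving[OF S(1,2), of "L \<inter> (pauli.perp S - S)"] by blast
  let ?S = "pauli.adjoin v S"
  have vG: "v \<in> W \<times> W" using v unfolding pauli.perp_def by blast
  have SG: "S \<subseteq> W \<times> W" "(wzero, wzero) \<in> S" using S(1) unfolding pauli.subgrp_def by blast+
  obtain C' where C': "stabilizes ?S C'" "qvec.dim C \<le> 2 * qvec.dim C'"
    using stabilizes_adjoin[OF S(1) _ C(1)] v(1) by blast
  \<comment> \<open>The complement shrinks to the elements orthogonal to \<open>v\<close> while the
    group grows, so no new bad elements appear.\<close>
  have "L \<inter> (pauli.perp ?S - ?S) \<subseteq> {e \<in> L \<inter> (pauli.perp S - S). pform e v = 1}"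
    using pauli.perp_adjoin[OF SG(1) vG SG(2)] unfolding pauli.adjoin_def by blast
  moreover have "finite L" using assms(1) finite_subset by fastforce
  ultimately have "card (L \<inter> (pauli.perp ?S - ?S)) \<le> card {e \<in> L \<inter> (pauli.perp S - S). pform e v = 1}"
    by (intro card_mono) auto
  then have "2 ^ Suc j * card (L \<inter> (pauli.perp ?S - ?S)) \<le> card L"
    using L v(2) by (intro order.trans[OF _ L]) simp
  moreover have "2 ^ (r * N) \<le> 2 ^ Suc j * qvec.dim C'"
    using C'(2) by (intro order.trans[OF C(2)]) simp
  moreover have "pauli.subgrp ?S" "?S \<subseteq> pauli.perp ?S" "card ?S = 2 ^ Suc j"
    using pauli.subgrp_adjoin[OF S(1) vG] pauli.isotropic_adjoin[OF S(1,2)]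
      pauli.card_adjoin[OF S(1) vG] v(1) S(3) by auto
  ultimately show ?case using C'(1) by blast
qed


section \<open>Error detection\<close>

text \<open>An operator in \<open>S\<close> is scalar on \<open>C\<close>. One outside
  \<open>perp S\<close> anticommutes with some \<open>s \<in> S\<close>; applying the unitary
  \<open>s\<close> to both arguments shows that the inner product equals its own negative.\<close>

lemma detectable_pauli_op:
  assumes S: "pauli.subgrp S" and C: "stabilizes S C"
    and e: "e \<in> W \<times> W" "e \<notin> pauli.perp S - S"
  shows "\<exists>c. \<forall>u\<in>C. \<forall>v\<in>C. qinner (2 ^ r) N u (pauli_op e v) = c * qinner (2 ^ r) N u v"
proof (cases "e \<in> S")
  case True
  then obtain c where "\<And>u. u \<in> C \<Longrightarrow> pauli_op e u = qscale c u"
    using C unfolding stabilizes_def by blast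
  then show ?thesis
    by (intro exI[of _ c]) (auto simp: qinner_def qscale_def sum_distrib_left mult_ac)
next
  case False
  have SG: "S \<subseteq> W \<times> W" using S unfolding pauli.subgrp_def by blast
  obtain s where s: "s \<in> S" "pform e s \<noteq> 1"
    using e False unfolding pauli.perp_def by blast
  have sG: "s \<in> W \<times> W" using s SG by blast
  have "pform s e = - 1"
    using s(2) pauli.omega_cases[OF e(1) sG] by (simp add: pform_def mult.commute)
  then have anti: "pauli_op s (pauli_op e v) = qscale (- 1) (pauli_op e (pauli_op s v))" for v
    using pauli_op_commute[OF sG e(1), of v] by simp
  obtain c where c: "cnj c * c = 1" "\<And>u. u \<in> C \<Longrightarrow> pauli_op s u = qscale c u"
    using C s(1) unfolding stabilizes_def by blast
  have "qinner (2 ^ r) N u (pauli_op e v) = 0" if uv: "u \<in> C" "v \<in> C" for u v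
  proof -
    have "qinner (2 ^ r) N u (pauli_op e v) =
        qinner (2 ^ r) N (qscale c u) (qscale (- c) (pauli_op e v))"
      using qinner_pauli_op[OF sG, of u "pauli_op e v"] uv c(2)
      by (simp add: anti pauli_op_scale)
    also have "\<dots> = - (cnj c * c) * qinner (2 ^ r) N u (pauli_op e v)"
      by (simp add: qinner_def qscale_def sum_distrib_left mult_ac sum_negf)
    finally show ?thesis using c(1) by simp
  qed
  then show ?thesis by (intro exI[of _ 0]) simp
qed

section \<open>Expansion of errors into Pauli operators\<close>

definition kernel :: "qerror \<Rightarrow> (nat \<Rightarrow> nat) \<Rightarrow> (nat \<Rightarrow> nat) \<Rightarrow> complex" where
  "kernel E x y = (\<Prod>i<N. E i (x i) (y i))"

text \<open>For each shift \<open>a\<close>, these are the Fourier coefficients on \<open>W\<close>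
  of the function sending \<open>x\<close> to \<open>kernel E x (wadd x a)\<close>.\<close>

definition pauli_coeff :: "qerror \<Rightarrow> (nat \<Rightarrow> nat) \<times> (nat \<Rightarrow> nat) \<Rightarrow> complex" where
  "pauli_coeff E p =
     (\<Sum>x\<in>W. kernel E x (wadd x (fst p)) * of_int (wchar (snd p) x)) / of_nat (card W)"

text \<open>Fourier inversion on \<open>W\<close> for each shift \<open>a\<close>, followed by the
  substitution \<open>y = wadd x a\<close> in the sum over \<open>a\<close>.\<close>

lemma apply_error_pauli:
  "apply_error (2 ^ r) N E v x = (\<Sum>p\<in>W \<times> W. pauli_coeff E p * pauli_op p v x)"
proof (cases "x \<in> W")
  case True
  have W0: "of_nat (card W) \<noteq> (0 :: complex)"
    by (simp add: card_W)
  have orth: "(\<Sum>b\<in>W. of_int (wchar b y) * of_int (wchar b x)) =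
      (if y = x then of_nat (card W) else (0 :: complex))" if "y \<in> W" for y
  proof -
    have "wadd y x = wzero \<longleftrightarrow> y = x"
      using True that by (metis add_cancel add_self add_commute add_zero zero_closed)
    moreover have "(\<Sum>b\<in>W. wchar b y * wchar b x) = (\<Sum>b\<in>W. wchar (wadd y x) b)"
      using True that by (intro sum.cong refl) (simp add: omega_add_right wchar_sym[of "wadd y x"] mult.commute)
    ultimately have "(\<Sum>b\<in>W. wchar b y * wchar b x) = (if y = x then int (card W) else 0)"
      using True that by (simp add: sum_omega)
    then have "of_int (\<Sum>b\<in>W. wchar b y * wchar b x) =
        (of_int (if y = x then int (card W) else 0) :: complex)"
      by (rule arg_cong)
    then show ?thesis
      by (simp split: if_splits)
  qed
  have "(\<Sum>p\<in>W \<times> W. pauli_coeff E p * pauli_op p v x) =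
      (\<Sum>a\<in>W. \<Sum>b\<in>W. pauli_coeff E (a, b) * pauli_op (a, b) v x)"
    by (simp add: sum.cartesian_product)
  also have "\<dots> = (\<Sum>a\<in>W. kernel E x (wadd x a) * v (wadd x a))"
  proof (intro sum.cong refl)
    fix a assume a: "a \<in> W"
    have "(\<Sum>b\<in>W. pauli_coeff E (a, b) * pauli_op (a, b) v x) =
        (\<Sum>b\<in>W. \<Sum>y\<in>W. v (wadd x a) * kernel E y (wadd y a) / of_nat (card W) *
          (of_int (wchar b y) * of_int (wchar b x)))"
      using True by (intro sum.cong refl)
        (simp add: pauli_coeff_def pauli_op_def sum_divide_distrib sum_distrib_left sum_distrib_right mult_ac)
    also have "\<dots> = (\<Sum>y\<in>W. \<Sum>b\<in>W. v (wadd x a) * kernel E y (wadd y a) / of_nat (card W) *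
          (of_int (wchar b y) * of_int (wchar b x)))"
      by (rule sum.swap)
    also have "\<dots> = (\<Sum>y\<in>W. v (wadd x a) * kernel E y (wadd y a) / of_nat (card W) *
          (if y = x then of_nat (card W) else 0))"
      by (intro sum.cong refl) (simp only: sum_distrib_left[symmetric] orth)
    also have "\<dots> = (\<Sum>y\<in>W. if y = x then v (wadd x a) * kernel E x (wadd x a) else 0)"
      using W0 by (intro sum.cong refl) auto
    also have "\<dots> = kernel E x (wadd x a) * v (wadd x a)"
      using True by simp
    finally show "(\<Sum>b\<in>W. pauli_coeff E (a, b) * pauli_op (a, b) v x) =
        kernel E x (wadd x a) * v (wadd x a)" .
  qed
  also have "\<dots> = (\<Sum>y\<in>W. kernel E x y * v y)"
    by (rule sum.reindex_bij_witness[where i = "\<lambda>a. wadd x a" and j = "\<lambda>a. wadd x a"])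
      (use True in \<open>simp_all add: add_commute[OF True]\<close>)
  finally show ?thesis
    using True by (simp add: apply_error_def kernel_def)
qed (simp add: apply_error_def pauli_op_def)

definition psupp :: "(nat \<Rightarrow> nat) \<times> (nat \<Rightarrow> nat) \<Rightarrow> nat set" where
  "psupp p = {i \<in> {..<N}. fst p i \<noteq> 0 \<or> snd p i \<noteq> 0}"

text \<open>Suppose \<open>E\<close> is the identity at \<open>i\<close>. If \<open>p\<close> shifts
  at \<open>i\<close>, an off-diagonal entry makes every kernel factor vanish. Otherwise flipping a
  suitable bit at \<open>i\<close> preserves the kernel and negates the character, so the terms
  cancel.\<close>

lemma pauli_coeff_eq_0:
  assumes p: "p \<in> W \<times> W" and i: "i \<in> psupp p"
    and E: "\<forall>a<2 ^ r. \<forall>b<2 ^ r. E i a b = (if a = b then 1 else 0)"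
  shows "pauli_coeff E p = 0"
proof -
  obtain a b where ab: "p = (a, b)" "a \<in> W" "b \<in> W" using p by blast
  have iN: "i < N" and ne: "a i \<noteq> 0 \<or> b i \<noteq> 0" using i ab by (auto simp: psupp_def)
  have "(\<Sum>x\<in>W. kernel E x (wadd x a) * of_int (wchar b x)) = 0"
  proof (cases "a i = 0")
    case False
    have "kernel E x (wadd x a) = 0" if x: "x \<in> W" for x
    proof -
      have "xor (x i) (a i) \<noteq> x i"
        using False by (metis xor.left_commute xor.right_neutral xor_self_eq)
      then have "x i \<noteq> wadd x a i" using iN by (simp add: wadd_def)
      moreover have "wadd x a i < 2 ^ r" using x ab by (intro words_less iN) simp
      ultimately have "E i (x i) (wadd x a i) = 0"
        using E words_less[OF x iN] by simp
      then show ?thesis using iN by (auto simp: kernel_def)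
    qed
    then show ?thesis by simp
  next
    case True
    then obtain j where j: "j < r" "bit (b i) j"
      using ne ex_bit[OF ab(3) iN] by auto
    let ?t = "wunit i j"
    have t: "?t \<in> W" "wchar b ?t = - 1"
      using j iN by (auto simp: wunit_in_W wchar_wunit)
    have "kernel E (wadd x ?t) (wadd (wadd x ?t) a) = kernel E x (wadd x a)" if x: "x \<in> W" for x
      unfolding kernel_def
    proof (intro prod.cong refl)
      fix k assume "k \<in> {..<N}"
      then have k: "k < N" by simp
      show "E k (wadd x ?t k) (wadd (wadd x ?t) a k) = E k (x k) (wadd x a k)"
      proof (cases "k = i")
        case k_eq: True
        have "wadd y a i = y i" if "y \<in> W" for y
          using iN True by (simp add: wadd_def)
        moreover have "wadd x ?t \<in> W" using x t by simp
        ultimately show ?thesis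
          using k_eq E x words_less[OF x iN] words_less[OF \<open>wadd x ?t \<in> W\<close> iN] by simp
      next
        case False
        then show ?thesis using k by (simp add: wadd_def wunit_def)
      qed
    qed
    then show ?thesis
      by (intro sum_sign_reversing_involution[where h = "\<lambda>x. wadd x ?t"])
        (use t ab in \<open>auto simp: omega_add_right\<close>)
  qed
  then show ?thesis by (simp add: pauli_coeff_def ab)
qed

text \<open>Only Pauli operators supported where \<open>E\<close> differs from the identity
  contribute. They have weight below \<open>d\<close>, hence lie in \<open>S\<close> or outside
  \<open>perp S\<close>, and the scalars of the Knill--Laflamme condition add up linearly.\<close>

lemma detectable_if_no_small_pauli:
  assumes S: "pauli.subgrp S" and C: "stabilizes S C"
    and L: "{p \<in> W \<times> W. card (psupp p) < d} \<inter> (pauli.perp S - S) = {}"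
    and E: "error_weight (2 ^ r) N E < d"
  shows "detectable (2 ^ r) N C E"
proof -
  define J where "J = {i \<in> {..<N}. \<exists>a<2 ^ r. \<exists>b<2 ^ r. E i a b \<noteq> (if a = b then 1 else 0)}"
  have "\<exists>c. \<forall>u\<in>C. \<forall>v\<in>C.
      pauli_coeff E p * qinner (2 ^ r) N u (pauli_op p v) = c * qinner (2 ^ r) N u v"
    if p: "p \<in> W \<times> W" for p
  proof (cases "psupp p \<subseteq> J")
    case True
    then have "card (psupp p) \<le> card J"
      by (intro card_mono) (simp_all add: J_def)
    also have "\<dots> < d"
      using E unfolding error_weight_def J_def .
    finally have "p \<notin> pauli.perp S - S"
      using p L by blast
    then obtain c where "\<And>u v. u \<in> C \<Longrightarrow> v \<in> C \<Longrightarrow>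
        qinner (2 ^ r) N u (pauli_op p v) = c * qinner (2 ^ r) N u v"
      using detectable_pauli_op[OF S C p] by blast
    then show ?thesis by (intro exI[of _ "pauli_coeff E p * c"]) simp
  next
    case False
    then obtain i where i: "i \<in> psupp p" "i \<notin> J" by blast
    then have "pauli_coeff E p = 0"
      by (intro pauli_coeff_eq_0[OF p i(1)]) (unfold J_def psupp_def, blast)
    then show ?thesis by (intro exI[of _ 0]) simp
  qed
  then obtain c where c: "\<And>p u v. p \<in> W \<times> W \<Longrightarrow> u \<in> C \<Longrightarrow> v \<in> C \<Longrightarrow>
      pauli_coeff E p * qinner (2 ^ r) N u (pauli_op p v) = c p * qinner (2 ^ r) N u v"
    by metis
  have "qinner (2 ^ r) N u (apply_error (2 ^ r) N E v) =
      (\<Sum>p\<in>W \<times> W. c p) * qinner (2 ^ r) N u v" if uv: "u \<in> C" "v \<in> C" for u v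
  proof -
    have "qinner (2 ^ r) N u (apply_error (2 ^ r) N E v) =
        (\<Sum>x\<in>W. \<Sum>p\<in>W \<times> W. pauli_coeff E p * (cnj (u x) * pauli_op p v x))"
      by (simp add: qinner_def apply_error_pauli sum_distrib_left mult_ac)
    also have "\<dots> = (\<Sum>p\<in>W \<times> W. \<Sum>x\<in>W. pauli_coeff E p * (cnj (u x) * pauli_op p v x))"
      by (rule sum.swap)
    also have "\<dots> = (\<Sum>p\<in>W \<times> W. pauli_coeff E p * qinner (2 ^ r) N u (pauli_op p v))"
      by (simp add: qinner_def sum_distrib_left)
    also have "\<dots> = (\<Sum>p\<in>W \<times> W. c p * qinner (2 ^ r) N u v)"
      using c uv by (intro sum.cong refl) blast
    finally show ?thesis by (simp add: sum_distrib_right)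
  qed
  then show ?thesis unfolding detectable_def by blast
qed

section \<open>Counting Pauli operators of low weight\<close>

lemma card_words_supported:
  assumes "J \<subseteq> {..<N}"
  shows "card {x \<in> W. \<forall>i<N. i \<notin> J \<longrightarrow> x i = 0} = 2 ^ (r * card J)"
proof -
  have "{x \<in> W. \<forall>i<N. i \<notin> J \<longrightarrow> x i = 0} = ({..<N} \<rightarrow>\<^sub>E {..<2 ^ r}) \<inter>
      {x. \<forall>i\<in>{..<N}. i \<notin> J \<longrightarrow> x i = 0}"
    by (auto simp: words_def)
  also have "\<dots> = (\<Pi>\<^sub>E i\<in>{..<N}. if i \<in> J then {..<2 ^ r} else {0})"
    by (auto simp: PiE_def Pi_def split: if_splits)
  also have "card \<dots> = (\<Prod>i<N. if i \<in> J then 2 ^ r else 1)"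
    by (subst card_PiE) (auto intro!: prod.cong)
  also have "\<dots> = (\<Prod>i\<in>J. 2 ^ r)"
    using assms by (simp add: prod.If_cases Int_absorb1)
  finally show ?thesis by (simp add: power_mult)
qed

text \<open>A union bound: the support extends to a set \<open>J\<close> of exactly \<open>t\<close>
  positions, which is possible as \<open>t \<le> N\<close>, and each component of a pair supported
  on \<open>J\<close> has \<open>2 ^ (r * t)\<close> choices.\<close>

lemma card_small_pauli:
  assumes "t \<le> N"
  shows "card {p \<in> W \<times> W. card (psupp p) < Suc t} \<le> (N choose t) * 2 ^ (2 * r * t)"
proof -
  let ?J = "{J. J \<subseteq> {..<N} \<and> card J = t}"
  let ?F = "\<lambda>J. {x \<in> W. \<forall>i<N. i \<notin> J \<longrightarrow> x i = 0}"
  have "{p \<in> W \<times> W. card (psupp p) < Suc t} \<subseteq> (\<Union>J\<in>?J. ?F J \<times> ?F J)"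
  proof
    fix p assume p: "p \<in> {p \<in> W \<times> W. card (psupp p) < Suc t}"
    have "psupp p \<subseteq> {..<N}" by (auto simp: psupp_def)
    moreover have "card (psupp p) \<le> t" "t \<le> card {..<N}" using p assms by auto
    ultimately obtain J where J: "psupp p \<subseteq> J" "J \<subseteq> {..<N}" "card J = t"
      using exists_subset_between[of "psupp p" t "{..<N}"] by auto
    then have "p \<in> ?F J \<times> ?F J"
      using p by (auto simp: psupp_def)
    then show "p \<in> (\<Union>J\<in>?J. ?F J \<times> ?F J)" using J by blast
  qed
  then have "card {p \<in> W \<times> W. card (psupp p) < Suc t} \<le> card (\<Union>J\<in>?J. ?F J \<times> ?F J)"
    by (intro card_mono finite_subset[of "(\<Union>J\<in>?J. ?F J \<times> ?F J)" "W \<times> W"]) auto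
  also have "\<dots> \<le> (\<Sum>J\<in>?J. card (?F J \<times> ?F J))"
    by (intro card_UN_le) (auto intro: finite_subset[of _ "Pow {..<N}"])
  also have "\<dots> = (\<Sum>J\<in>?J. 2 ^ (2 * r * t))"
    by (intro sum.cong refl) (auto simp: card_cartesian_product card_words_supported
        power_add[symmetric] mult_2 distrib_right)
  also have "\<dots> = (N choose t) * 2 ^ (2 * r * t)"
    by (simp add: n_subsets)
  finally show ?thesis .
qed

text \<open>If all matrix units were detectable, then a coordinate at which some codeword does not vanish
  would determine every codeword.\<close>

lemma ex_undetectable:
  assumes C: "qvec.subspace C" "C \<subseteq> qspace (2 ^ r) N" "qvec.dim C > 1"
  shows "\<exists>E. \<not> detectable (2 ^ r) N C E"
proof (rule ccontr)
  assume det: "\<nexists>E. \<not> detectable (2 ^ r) N C E"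
  have "\<exists>c. \<forall>u\<in>C. \<forall>v\<in>C. cnj (u x) * v x = c * qinner (2 ^ r) N u v" if x: "x \<in> W" for x
  proof -
    \<comment> \<open>A tensor product of diagonal matrix units, equal to the projection onto the
      basis vector \<open>delta x\<close>.\<close>
    define E :: qerror where "E = (\<lambda>i a b. of_bool (a = x i \<and> b = x i))"
    have ker: "kernel E y z = (if y = x \<and> z = x then 1 else 0)" if "y \<in> W" "z \<in> W" for y z
    proof (cases "y = x \<and> z = x")
      case False
      have "\<exists>i<N. y i \<noteq> x i \<or> z i \<noteq> x i"
      proof (rule ccontr)
        assume "\<not> ?thesis"
        then have "y = x" "z = x"
          using that x by (auto intro: words_eqI)
        then show False using False by simp
      qed
      then have "\<exists>i\<in>{..<N}. E i (y i) (z i) = 0"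
        by (auto simp: E_def)
      then show ?thesis using False by (auto simp: kernel_def)
    qed (simp add: kernel_def E_def)
    have app: "apply_error (2 ^ r) N E v y = (if y = x then v x else 0)" for v y
    proof (cases "y \<in> W")
      case True
      have "apply_error (2 ^ r) N E v y = (\<Sum>z\<in>W. kernel E y z * v z)"
        using True by (simp add: apply_error_def kernel_def)
      also have "\<dots> = (\<Sum>z\<in>W. if z = x then if y = x then v x else 0 else 0)"
        using True ker by (intro sum.cong refl) auto
      also have "\<dots> = (if y = x then v x else 0)"
        using x by simp
      finally show ?thesis .
    qed (use x in \<open>auto simp: apply_error_def\<close>)
    have "qinner (2 ^ r) N u (apply_error (2 ^ r) N E v) = cnj (u x) * v x" for u v
    proof -
      have "qinner (2 ^ r) N u (apply_error (2 ^ r) N E v) =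
          (\<Sum>y\<in>W. if y = x then cnj (u x) * v x else 0)"
        unfolding app qinner_def by (intro sum.cong refl) auto
      then show ?thesis using x by simp
    qed
    moreover have "detectable (2 ^ r) N C E" using det by blast
    ultimately show ?thesis unfolding detectable_def by simp
  qed
  then obtain c where c: "\<And>x u v. x \<in> W \<Longrightarrow> u \<in> C \<Longrightarrow> v \<in> C \<Longrightarrow>
      cnj (u x) * v x = c x * qinner (2 ^ r) N u v"
    by metis
  obtain u x where u: "u \<in> C" "x \<in> W" "u x \<noteq> 0"
  proof -
    have "\<not> C \<subseteq> {0}"
      using C(3) qvec.dim_le_card[of C "{}"] by auto
    then obtain u where "u \<in> C" "u \<noteq> 0" by blast
    then obtain x where "u x \<noteq> 0" by (auto simp: fun_eq_iff)
    then show thesis using that \<open>u \<in> C\<close> C(2) by (auto simp: qspace_def)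
  qed
  have cx: "c x \<noteq> 0"
    using c[of x u u] u by auto
  have "C \<subseteq> qvec.span {u}"
  proof
    fix v assume v: "v \<in> C"
    \<comment> \<open>This combination vanishes at \<open>x\<close>. As
      \<open>c x \<noteq> 0\<close>, its norm is zero, and then so is every coordinate; thus
      \<open>v\<close> is a multiple of \<open>u\<close>.\<close>
    define w where "w = qscale (u x) v - qscale (v x) u"
    have w: "w \<in> C"
      using v u C by (simp add: w_def qvec.subspace_diff qvec.subspace_scale)
    have "w x = 0" by (simp add: w_def qscale_def)
    then have "qinner (2 ^ r) N w w = 0"
      using c[of x w w] w u cx by simp
    then have "w y = 0" if "y \<in> W" for y
      using c[OF that w w] by simp
    then have "w = 0"
      using w C(2) by (auto simp: qspace_def fun_eq_iff)
    then have "qscale (u x) v = qscale (v x) u" by (simp add: w_def)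
    then have "qscale (1 / u x) (qscale (u x) v) = qscale (1 / u x) (qscale (v x) u)" by simp
    then have "v = qscale (v x / u x) u" using u by simp
    then show "v \<in> qvec.span {u}"
      by (metis insertI1 qvec.span_base qvec.span_scale)
  qed
  then show False
    using qvec.dim_le_card[of C "{u}"] C(3) by simp
qed

text \<open>After \<open>r * (N - s)\<close> rounds of halving, fewer than one bad operator of
  weight at most \<open>t\<close> is left, while the dimension is still at least
  \<open>2 ^ (r * s)\<close>.\<close>

theorem quantum_gilbert_varshamov:
  assumes r: "r \<ge> 1" and s: "1 \<le> s" "s \<le> N" and t: "t \<le> N"
    and bound: "(N choose t) * 2 ^ (2 * r * t) < 2 ^ (r * (N - s))"
  shows "\<exists>C D. quantum_code (2 ^ r) N s D C \<and> t < D"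
proof -
  define L where "L = {p \<in> W \<times> W. card (psupp p) < Suc t}"
  have "r * (N - s) \<le> r * N" by simp
  moreover have "L \<subseteq> W \<times> W" by (auto simp: L_def)
  ultimately obtain S C where S: "pauli.subgrp S"
    "2 ^ (r * (N - s)) * card (L \<inter> (pauli.perp S - S)) \<le> card L"
    and C: "stabilizes S C" "2 ^ (r * N) \<le> 2 ^ (r * (N - s)) * qvec.dim C"
    using ex_stabilizer_code by blast
  have "card L < 2 ^ (r * (N - s))"
    using card_small_pauli[OF t] bound unfolding L_def by linarith
  then have "card (L \<inter> (pauli.perp S - S)) = 0"
    using S(2) by (cases "card (L \<inter> (pauli.perp S - S))") auto
  moreover have "finite L" by (auto simp: L_def)
  ultimately have L: "L \<inter> (pauli.perp S - S) = {}" by simp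
  have "(2 :: nat) ^ (r * N) = 2 ^ (r * (N - s)) * 2 ^ (r * s)"
    using s(2) by (simp flip: power_add add_mult_distrib2)
  then have dim: "2 ^ (r * s) \<le> qvec.dim C"
    using C(2) by simp
  obtain B where B: "B \<subseteq> C" "qvec.independent B" "card B = qvec.dim C"
    using qvec.basis_exists by metis
  \<comment> \<open>The dimension must be exact, so a subspace is cut out; detectability passes to
    subspaces.\<close>
  obtain B' where B': "B' \<subseteq> B" "card B' = 2 ^ (r * s)"
    using dim B(3) by (metis obtain_subset_with_card_n)
  define C' where "C' = qvec.span B'"
  have C': "qvec.subspace C'" "C' \<subseteq> C" "qvec.dim C' = 2 ^ (r * s)"
  proof -
    have "qvec.independent B'" using B B' qvec.independent_mono by blast
    then show "qvec.dim C' = 2 ^ (r * s)"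
      using B' by (simp add: C'_def qvec.dim_eq_card_independent)
    show "C' \<subseteq> C"
      using B B' C(1) unfolding C'_def stabilizes_def by (intro qvec.span_minimal) auto
  qed (simp add: C'_def)
  have C'q: "C' \<subseteq> qspace (2 ^ r) N"
    using C' C(1) unfolding stabilizes_def by blast
  have det: "detectable (2 ^ r) N C' E" if "error_weight (2 ^ r) N E < Suc t" for E
    using detectable_if_no_small_pauli[OF S(1) C(1) L[unfolded L_def] that] C'(2)
    unfolding detectable_def by blast
  have "(1 :: nat) < 2 ^ (r * s)"
    using r s by (intro one_less_power) auto
  then have "\<exists>E. \<not> detectable (2 ^ r) N C' E"
    using C' C'q by (intro ex_undetectable) auto
  then have ex: "\<exists>d E. error_weight (2 ^ r) N E = d \<and> \<not> detectable (2 ^ r) N C' E" by blast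
  \<comment> \<open>The exact distance is the least weight of an undetectable error; one exists
    because the dimension exceeds \<open>1\<close>.\<close>
  define D where "D = (LEAST d. \<exists>E. error_weight (2 ^ r) N E = d \<and> \<not> detectable (2 ^ r) N C' E)"
  have D: "\<exists>E. error_weight (2 ^ r) N E = D \<and> \<not> detectable (2 ^ r) N C' E"
    unfolding D_def by (rule LeastI_ex[OF ex])
  have "detectable (2 ^ r) N C' E" if "error_weight (2 ^ r) N E < D" for E
    using not_less_Least[OF that[unfolded D_def]] by blast
  then have "quantum_code (2 ^ r) N s D C'"
    using C' C'q D by (simp add: quantum_code_def power_mult)
  moreover have "t < D"
    using D det by (metis not_less_eq)
  ultimately show ?thesis by blast
qed

end

section \<open>Parameters\<close>

text \<open>The last \<open>k\<close> factors of the factorial all exceed \<open>w\<close>. With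
  \<open>k = 2 * w\<close> this bounds the factorial of \<open>3 * w\<close> in the denominator of
  the binomial coefficient.\<close>

lemma power_le_fact_add: "w ^ k \<le> (fact (w + k) :: nat)"
proof (induction k)
  case (Suc k)
  have "w ^ Suc k \<le> Suc (w + k) * fact (w + k)"
    unfolding power_Suc using Suc by (intro mult_le_mono) auto
  then show ?case by simp
qed simp

text \<open>Dividing \<open>N ^ (3 * w)\<close>, at most \<open>(4 * (w * w)) ^ (3 * w)\<close>, by
  \<open>w ^ (2 * w)\<close> leaves \<open>2 ^ (6 * w + n * (4 * w))\<close>. It remains to see that
  \<open>6 * w < n * (2 * w - 18)\<close>, which holds for \<open>n \<ge> 5\<close> and
  \<open>w \<ge> 32\<close>.\<close>

lemma binomial_less_power:
  assumes n: "n \<ge> 5" and w: "w = 2 ^ n" and N: "N = 4 * w * w - 4 * w" and t: "t \<le> 3 * w"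
  shows "N choose t < 2 ^ (2 * n * (3 * w - 9))"
proof -
  have w32: "w \<ge> 32"
    using power_increasing[of 5 n "2 :: nat"] n w by simp
  have ww: "w * w \<ge> 32 * w" using w32 by simp
  have "N choose t \<le> N choose (3 * w)"
  proof (rule binomial_mono[OF t])
    show "2 * (3 * w) \<le> N" using ww N w32 unfolding mult.assoc by linarith
  qed
  also have "\<dots> < 2 ^ (2 * n * (3 * w - 9))"
  proof -
    have "w ^ (2 * w) * (N choose (3 * w)) \<le> fact (w + 2 * w) * (N choose (3 * w))"
      by (intro mult_le_mono1 power_le_fact_add)
    also have "\<dots> \<le> N ^ (3 * w)"
      using binomial_fact_pow[of N "3 * w"] by (simp add: mult.commute)
    also have "\<dots> \<le> (4 * (w * w)) ^ (3 * w)"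
      using N by (intro power_mono) auto
    also have "\<dots> = w ^ (2 * w) * (4 ^ (3 * w) * w ^ (4 * w))"
      by (simp add: power_mult_distrib power_add[symmetric])
    finally have "N choose (3 * w) \<le> 4 ^ (3 * w) * w ^ (4 * w)"
      using w32 by (subst (asm) mult_le_cancel1) auto
    also have "\<dots> = 2 ^ (6 * w + n * (4 * w))"
    proof -
      have "(4 :: nat) ^ (3 * w) = 2 ^ (6 * w)"
        using power_mult[of "2 :: nat" 2 "3 * w"] by simp
      then show ?thesis by (simp add: w power_add power_mult)
    qed
    also have "\<dots> < 2 ^ (2 * n * (3 * w - 9))"
    proof (rule power_strict_increasing)
      have "5 * (2 * w - 18) \<le> n * (2 * w - 18)" using n by simp
      then have "6 * w < n * (2 * w - 18)" using w32 by linarith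
      then have "6 * w + n * (4 * w) < n * (2 * w - 18) + n * (4 * w)" by simp
      also have "\<dots> = n * (6 * w - 18)"
        using w32 by (simp flip: add_mult_distrib2)
      also have "\<dots> = 2 * n * (3 * w - 9)" by (simp add: algebra_simps diff_mult_distrib2)
      finally show "6 * w + n * (4 * w) < 2 * n * (3 * w - 9)" .
    qed simp
    finally show ?thesis .
  qed
  finally show ?thesis .
qed

theorem proposition6p6:
  fixes q n m g N l k s :: nat
  assumes "q = 2"
    and "n \<ge> 5" and "odd n"
    and "real m = (2 ^ n + 1) / 3"
    and "real g = (real q - 1) * (real q ^ (n + 1) + real q ^ n - real q ^ 2) / 2"
    and "int N = int q ^ (2 * n + 2) - int q ^ (n + 3) + int q ^ (n + 2)"
    and "int l \<in> {int g..3 * int g - 1}"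
    and "k \<in> {m..<2 * m}"
    and "GGS_rho m (l + 1) = GGS_elt m 0 1 k"
    and "int s \<in> {1..int N - 2 * int l - 5}"
  shows "\<exists>C D. quantum_code (q ^ (2 * n)) N s D C \<and>
    int D \<ge> int l + 1 - int g +
      (if k < m \<or> (m \<le> k \<and> real k < (9 * real m - 11) / 8) then 5
       else if (9 * real m - 11) / 8 \<le> real k \<and> real k < (11 * real m - 9) / 8 then 3
       else 1)"
proof -
  define w :: nat where "w = 2 ^ n"
  have w32: "w \<ge> 32"
    using power_increasing[of 5 n "2 :: nat"] assms(2) w_def by simp
  have "real g = real (3 * w - 4) / 2"
    using assms(1,5) w32 by (simp add: w_def of_nat_diff)
  then have "real (2 * g) = real (3 * w - 4)" by simp
  then have g: "2 * g + 4 = 3 * w" using w32 by linarith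
  have "int N = 4 * int w * int w - 4 * int w"
    using assms(1,6) by (simp add: w_def power_add power_even_eq power2_eq_square)
  then have "int (N + 4 * w) = int (4 * w * w)" by simp
  then have N: "N = 4 * w * w - 4 * w"
    unfolding of_nat_eq_iff by linarith
  have l: "g \<le> l" "l < 3 * g" using assms(7) by auto
  have s: "1 \<le> s" "s + 2 * l + 5 \<le> N" using assms(10) by auto
  \<comment> \<open>With this choice \<open>t < D\<close> means
    \<open>D \<ge> l + 1 - g + 5\<close>, and \<open>5\<close> is the largest of the three
    increments. The upper limit \<open>l \<le> 3 * g - 1\<close> gives
    \<open>t \<le> 2 * g + 4 = 3 * w\<close>.\<close>
  define t where "t = l + 5 - g"
  have t: "t \<le> 3 * w" "t \<le> N" using l g s by (auto simp: t_def)
  have "(N choose t) * 2 ^ (2 * (2 * n) * t) < 2 ^ (2 * n * (3 * w - 9)) * 2 ^ (2 * (2 * n) * t)"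
    using binomial_less_power[OF assms(2) w_def N t(1)] by simp
  also have "\<dots> = 2 ^ (2 * n * (3 * w - 9 + 2 * t))"
  proof -
    have "2 * n * (3 * w - 9 + 2 * t) = 2 * n * (3 * w - 9) + 2 * (2 * n) * t"
      unfolding add_mult_distrib2 by simp
    then show ?thesis by (simp only: power_add)
  qed
  also have "\<dots> \<le> 2 ^ (2 * n * (N - s))"
  proof (intro power_increasing mult_le_mono order_refl)
    \<comment> \<open>By \<open>2 * g + 4 = 3 * w\<close> the left side is exactly
      \<open>2 * l + 5\<close>, which accounts for the constant \<open>9\<close>.\<close>
    show "3 * w - 9 + 2 * t \<le> N - s" using s l g w32 unfolding t_def by linarith
  qed simp
  finally have "(N choose t) * 2 ^ (2 * (2 * n) * t) < 2 ^ (2 * n * (N - s))" .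
  moreover have "1 \<le> 2 * n" "s \<le> N" using assms(2) s(2) by simp_all
  ultimately obtain C D where CD: "quantum_code (2 ^ (2 * n)) N s D C" "t < D"
    using qudits.quantum_gilbert_varshamov s(1) t(2) by blast
  have "int D \<ge> int l + 1 - int g + 5"
    using CD(2) l by (simp add: t_def)
  then have "int D \<ge> int l + 1 - int g +
      (if k < m \<or> (m \<le> k \<and> real k < (9 * real m - 11) / 8) then 5
       else if (9 * real m - 11) / 8 \<le> real k \<and> real k < (11 * real m - 9) / 8 then 3
       else 1)"
    by (simp split: if_split)
  then show ?thesis
    using CD(1) unfolding assms(1) by blast
qed

end
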